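(* In $L(\mathfrak{sl}_2)^+$ define, for $i\geq 0$, $$A^{\uparrow\uparrow}_i=x\otimes(t-1)^i,\qquad B^{\uparrow\uparrow}_i=(y\otimes t+z\otimes(t-1))(t-1)^i,\qquad \psi^{\uparrow\uparrow}_i=z\otimes(t-1)^i.$$ Then the Onsager Lie algebra $O$ has a basis $$A^{\uparrow\uparrow}_i,\qquad B^{\uparrow\uparrow}_i,\qquad \psi^{\uparrow\uparrow}_{i+1},\qquad i\in\mathbb{N},$$ where $A^{\uparrow\uparrow}_0=A$ and $B^{\uparrow\uparrow}_0=B$. The Lie bracket acts on this basis as follows. For $i,j\in\mathbb{N}$, $$\begin{aligned} [A^{\uparrow\uparrow}_i,A^{\uparrow\uparrow}_j]&=0,\\ [B^{\uparrow\uparrow}_i,B^{\uparrow\uparrow}_j]&=0,\\ [\psi^{\uparrow\uparrow}_i,\psi^{\uparrow\uparrow}_j]&=0,\\ [\psi^{\uparrow\uparrow}_i,A^{\uparrow\uparrow}_j]&=2\psi^{\uparrow\uparrow}_{i+j}+2A^{\uparrow\uparrow}_{i+j},\\ [B^{\uparrow\uparrow}_i,\psi^{\uparrow\uparrow}_j]&=2B^{\uparrow\uparrow}_{i+j}+2\psi^{\uparrow\uparrow}_{i+j},\\ [A^{\uparrow\uparrow}_i,B^{\uparrow\uparrow}_j]&=2A^{\uparrow\uparrow}_{i+j}+2B^{\uparrow\uparrow}_{i+j}-4\psi^{\uparrow\uparrow}_{i+j+1}. \end{aligned}$$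
   Context: $\mathbb{F}$ is a field of characteristic zero; $\mathbb{N}=\{0,1,2,\ldots\}$; tensor products are over $\mathbb{F}$. $\mathfrak{sl}_2$ is the Lie algebra over $\mathbb{F}$ with basis $e,f,h$ and $[h,e]=2e$, $[h,f]=-2f$, $[e,f]=h$. Its equitable basis is $x=2e-h$, $y=-2f-h$, $z=h$, which satisfies $[x,y]=2x+2y$, $[y,z]=2y+2z$, $[z,x]=2z+2x$. Let $t$ be an indeterminate and $\mathcal{A}=\mathbb{F}[t,t^{-1},(t-1)^{-1}]$. The three-point $\mathfrak{sl}_2$ loop algebra $L(\mathfrak{sl}_2)^+$ is the vector space $\mathfrak{sl}_2\otimes\mathcal{A}$ with Lie bracket $[u\otimes a,v\otimes b]=[u,v]\otimes ab$. It is a right $\mathcal{A}$-module via $(u\otimes a)b=u\otimes ab$. The Onsager Lie algebra $O$ is the Lie algebra over $\mathbb{F}$ with generators $A,B$ and relations $[A,[A,[A,B]]]=4[A,B]$, $[B,[B,[B,A]]]=4[B,A]$. There is an injective Lie algebra homomorphism $O\to L(\mathfrak{sl}_2)^+$ with $A\mapsto x\otimes 1$, $B\mapsto y\otimes t+z\otimes(t-1)$, and $O$ is identified with its image; so $O$ is the Lie subalgebra of $L(\mathfrak{sl}_2)^+$ generated by $A=x\otimes1$ and $B=y\otimes t+z\otimes(t-1)$. The brackets in the claim are taken in $L(\mathfrak{sl}_2)^+$ (the element with index $0$ of the $\psi$ family does not lie in $O$). *)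

theory Defs
  imports Complex_Main "HOL-Computational_Algebra.Computational_Algebra"
begin

definition (in vector_space) basis_family :: "('i \<Rightarrow> 'b) \<Rightarrow> 'b set \<Rightarrow> bool"
  where "basis_family b V \<longleftrightarrow> inj b \<and> independent (range b) \<and> span (range b) = V"

locale lie_algebra = vector_space scale
  for scale :: "'a::field \<Rightarrow> 'b::ab_group_add \<Rightarrow> 'b" +
  fixes bracket :: "'b \<Rightarrow> 'b \<Rightarrow> 'b"
  assumes bracket_add_left: "bracket (u + v) w = bracket u w + bracket v w"
    and bracket_add_right: "bracket u (v + w) = bracket u v + bracket u w"
    and bracket_scale_left: "bracket (scale c u) v = scale c (bracket u v)"
    and bracket_scale_right: "bracket u (scale c v) = scale c (bracket u v)"
    and bracket_self: "bracket u u = 0"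
    and jacobi: "bracket u (bracket v w) + bracket v (bracket w u) + bracket w (bracket u v) = 0"
begin

definition lie_subalgebra :: "'b set \<Rightarrow> bool"
  where "lie_subalgebra S \<longleftrightarrow> subspace S \<and> (\<forall>u\<in>S. \<forall>v\<in>S. bracket u v \<in> S)"

definition generated_subalgebra :: "'b set \<Rightarrow> 'b set"
  where "generated_subalgebra S = lie_subalgebra hull S"

lemma lie_subalgebra_Inter:
  assumes "\<And>T. T \<in> C \<Longrightarrow> lie_subalgebra T"
  shows "lie_subalgebra (\<Inter>C)"
  using assms unfolding lie_subalgebra_def subspace_def by blast

lemma lie_subalgebra_generated: "lie_subalgebra (generated_subalgebra S)"
  unfolding generated_subalgebra_def by (rule hull_in) (blast intro: lie_subalgebra_Inter)

lemma generators_subset: "S \<subseteq> generated_subalgebra S"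
  unfolding generated_subalgebra_def by (rule hull_subset)

lemma generated_subalgebra_minimal:
  "S \<subseteq> T \<Longrightarrow> lie_subalgebra T \<Longrightarrow> generated_subalgebra S \<subseteq> T"
  unfolding generated_subalgebra_def by (rule hull_minimal)

end


section \<open>The algebra \<open>\<A> = F[t, 1/t, 1/(t-1)]\<close>\<close>

text \<open>The smallest subalgebra of the field of rational functions \<open>F(t)\<close> that contains
  \<open>t\<close>, \<open>1/t\<close> and \<open>1/(t-1)\<close>; \<open>Fract [:0, 1:] 1\<close> is the indeterminate \<open>t\<close>.\<close>

inductive_set three_point_set :: "'a::field poly fract set"
  where
    const: "Fract [:c:] 1 \<in> three_point_set"
  | t: "Fract [:0, 1:] 1 \<in> three_point_set"
  | inv_t: "inverse (Fract [:0, 1:] 1) \<in> three_point_set"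
  | inv_t1: "inverse (Fract [:0, 1:] 1 - 1) \<in> three_point_set"
  | add: "r \<in> three_point_set \<Longrightarrow> s \<in> three_point_set \<Longrightarrow> r + s \<in> three_point_set"
  | mult: "r \<in> three_point_set \<Longrightarrow> s \<in> three_point_set \<Longrightarrow> r * s \<in> three_point_set"

typedef (overloaded) 'a three_point = "three_point_set :: 'a::field poly fract set"
  using three_point_set.t by blast

setup_lifting type_definition_three_point

instantiation three_point :: (field) comm_ring_1
begin

lift_definition zero_three_point :: "'a three_point" is 0
  using three_point_set.const[of 0] by (simp add: Zero_fract_def)

lift_definition one_three_point :: "'a three_point" is 1
  using three_point_set.const[of 1] by (simp add: One_fract_def one_pCons)

lift_definition plus_three_point :: "'a three_point \<Rightarrow> 'a three_point \<Rightarrow> 'a three_point"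
  is "(+)" by (rule three_point_set.add)

lift_definition times_three_point :: "'a three_point \<Rightarrow> 'a three_point \<Rightarrow> 'a three_point"
  is "(*)" by (rule three_point_set.mult)

lift_definition uminus_three_point :: "'a three_point \<Rightarrow> 'a three_point" is uminus
proof -
  fix r :: "'a poly fract"
  assume "r \<in> three_point_set"
  then have "Fract [:-1:] 1 * r \<in> three_point_set"
    by (intro three_point_set.mult three_point_set.const)
  moreover have "Fract [:-1:] 1 * r = - r"
    by (cases r) (simp add: one_pCons flip: minus_fract)
  ultimately show "- r \<in> three_point_set" by simp
qed

definition minus_three_point :: "'a three_point \<Rightarrow> 'a three_point \<Rightarrow> 'a three_point"
  where "minus_three_point r s = r + - s"

instance
  by standard
    (unfold minus_three_point_def, (transfer, simp add: algebra_simps)+)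

end

lift_definition tp_const :: "'a::field \<Rightarrow> 'a three_point" is "\<lambda>c. Fract [:c:] 1"
  by (rule three_point_set.const)

lift_definition tp_t :: "'a::field three_point" is "Fract [:0, 1:] 1"
  by (rule three_point_set.t)

lemma tp_const_add: "tp_const (c + d) = tp_const c + tp_const d"
  by transfer simp

lemma tp_const_mult: "tp_const (c * d) = tp_const c * tp_const d"
  by transfer (simp add: mult.commute)

lemma tp_const_0: "tp_const 0 = 0"
  by transfer (simp add: Zero_fract_def)

lemma tp_const_1: "tp_const 1 = 1"
  by transfer (simp add: One_fract_def one_pCons)

lemma tp_const_minus: "tp_const (- c) = - tp_const c"
  using tp_const_add[of c "- c"] by (simp add: tp_const_0 add_eq_0_iff)

lemma tp_const_diff: "tp_const (c - d) = tp_const c - tp_const d"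
  using tp_const_add[of c "- d"] by (simp add: tp_const_minus)

lemma tp_const_of_nat: "tp_const (of_nat n) = of_nat n"
  by (induction n) (simp_all add: tp_const_0 tp_const_1 tp_const_add)

lemma tp_const_numeral: "tp_const (numeral n) = numeral n"
  using tp_const_of_nat[of "numeral n"] by simp

lemma tp_t_unit: "\<exists>u. tp_t * u = (1 :: 'a::field three_point)"
  by transfer (auto intro!: bexI[OF _ three_point_set.inv_t] right_inverse
      simp: Zero_fract_def eq_fract)

lemma tp_t1_unit: "\<exists>u. (tp_t - 1) * u = (1 :: 'a::field three_point)"
  unfolding minus_three_point_def
  by transfer (auto intro!: bexI[OF _ three_point_set.inv_t1] right_inverse
      simp: One_fract_def eq_fract one_pCons)


section \<open>The Lie algebra \<open>sl\<^sub>2\<close>\<close>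

text \<open>\<open>Sl2 a b c\<close> stands for \<open>a e + b f + c h\<close>.\<close>

datatype 'a sl2 = Sl2 (e_coeff: 'a) (f_coeff: 'a) (h_coeff: 'a)

instantiation sl2 :: (ab_group_add) ab_group_add
begin

definition "0 = Sl2 0 0 0"
definition "u + v = Sl2 (e_coeff u + e_coeff v) (f_coeff u + f_coeff v) (h_coeff u + h_coeff v)"
definition "- u = Sl2 (- e_coeff u) (- f_coeff u) (- h_coeff u)"
definition "u - v = Sl2 (e_coeff u - e_coeff v) (f_coeff u - f_coeff v) (h_coeff u - h_coeff v)"

instance
  by standard
    (simp_all add: zero_sl2_def plus_sl2_def uminus_sl2_def minus_sl2_def algebra_simps)

end

lemma sl2_coeffs [simp]:
  "e_coeff 0 = 0" "f_coeff 0 = 0" "h_coeff 0 = 0"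
  "e_coeff (u + v) = e_coeff u + e_coeff v"
  "f_coeff (u + v) = f_coeff u + f_coeff v"
  "h_coeff (u + v) = h_coeff u + h_coeff v"
  "e_coeff (- u) = - e_coeff u" "f_coeff (- u) = - f_coeff u" "h_coeff (- u) = - h_coeff u"
  "e_coeff (u - v) = e_coeff u - e_coeff v"
  "f_coeff (u - v) = f_coeff u - f_coeff v"
  "h_coeff (u - v) = h_coeff u - h_coeff v"
  by (simp_all add: zero_sl2_def plus_sl2_def uminus_sl2_def minus_sl2_def)

lemma sl2_eq_iff:
  "u = v \<longleftrightarrow> e_coeff u = e_coeff v \<and> f_coeff u = f_coeff v \<and> h_coeff u = h_coeff v"
  by (cases u; cases v) auto

definition sl2_scale :: "'a::comm_ring_1 \<Rightarrow> 'a sl2 \<Rightarrow> 'a sl2"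
  where "sl2_scale c u = Sl2 (c * e_coeff u) (c * f_coeff u) (c * h_coeff u)"

lemma sl2_scale_coeffs [simp]:
  "e_coeff (sl2_scale c u) = c * e_coeff u"
  "f_coeff (sl2_scale c u) = c * f_coeff u"
  "h_coeff (sl2_scale c u) = c * h_coeff u"
  by (simp_all add: sl2_scale_def)

text \<open>The bilinear alternating bracket with \<open>[h,e] = 2e\<close>, \<open>[h,f] = -2f\<close>, \<open>[e,f] = h\<close>.\<close>

definition sl2_bracket :: "'a::comm_ring_1 sl2 \<Rightarrow> 'a sl2 \<Rightarrow> 'a sl2"
  where "sl2_bracket u v = Sl2
    (2 * (h_coeff u * e_coeff v - e_coeff u * h_coeff v))
    (- 2 * (h_coeff u * f_coeff v - f_coeff u * h_coeff v))
    (e_coeff u * f_coeff v - f_coeff u * e_coeff v)"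

definition sl2_e :: "'a::comm_ring_1 sl2" where "sl2_e = Sl2 1 0 0"
definition sl2_f :: "'a::comm_ring_1 sl2" where "sl2_f = Sl2 0 1 0"
definition sl2_h :: "'a::comm_ring_1 sl2" where "sl2_h = Sl2 0 0 1"

definition sl2_x :: "'a::comm_ring_1 sl2" where "sl2_x = sl2_scale 2 sl2_e - sl2_h"
definition sl2_y :: "'a::comm_ring_1 sl2" where "sl2_y = sl2_scale (- 2) sl2_f - sl2_h"
definition sl2_z :: "'a::comm_ring_1 sl2" where "sl2_z = sl2_h"

lemma sl2_bracket_basis:
  "sl2_bracket sl2_h sl2_e = sl2_scale 2 sl2_e"
  "sl2_bracket sl2_h sl2_f = sl2_scale (- 2) sl2_f"
  "sl2_bracket sl2_e sl2_f = sl2_h"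
  by (simp_all add: sl2_bracket_def sl2_e_def sl2_f_def sl2_h_def sl2_scale_def)

lemma sl2_bracket_equitable:
  "sl2_bracket sl2_x sl2_y = sl2_scale 2 sl2_x + sl2_scale 2 sl2_y"
  "sl2_bracket sl2_y sl2_z = sl2_scale 2 sl2_y + sl2_scale 2 sl2_z"
  "sl2_bracket sl2_z sl2_x = sl2_scale 2 sl2_z + sl2_scale 2 sl2_x"
  by (simp_all add: sl2_eq_iff sl2_bracket_def sl2_x_def sl2_y_def sl2_z_def
      sl2_e_def sl2_f_def sl2_h_def)

interpretation sl2: lie_algebra "sl2_scale :: 'a::field \<Rightarrow> _" sl2_bracket
  by unfold_locales (simp_all add: sl2_eq_iff sl2_bracket_def algebra_simps)


section \<open>The three-point loop algebra \<open>L(sl\<^sub>2)\<^sup>+ = sl\<^sub>2 \<otimes> \<A>\<close>\<close>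

text \<open>Since \<open>e, f, h\<close> is a basis of \<open>sl\<^sub>2\<close>, every element of \<open>sl\<^sub>2 \<otimes> \<A>\<close> is uniquely
  \<open>e \<otimes> a + f \<otimes> b + h \<otimes> c\<close> with \<open>a, b, c \<in> \<A>\<close>; it is represented by \<open>Sl2 a b c\<close>.
  Lemma \<open>tensor_universal\<close> below is the universal property of this tensor product.\<close>

type_synonym 'a loop = "'a three_point sl2"

definition tensor :: "'a::field sl2 \<Rightarrow> 'a three_point \<Rightarrow> 'a loop"  (infixl "\<otimes>" 75)
  where "u \<otimes> a = Sl2 (tp_const (e_coeff u) * a) (tp_const (f_coeff u) * a) (tp_const (h_coeff u) * a)"

definition loop_scale :: "'a::field \<Rightarrow> 'a loop \<Rightarrow> 'a loop"
  where "loop_scale c = sl2_scale (tp_const c)"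

definition loop_rmult :: "'a::field loop \<Rightarrow> 'a three_point \<Rightarrow> 'a loop"  (infixl "\<cdot>" 75)
  where "X \<cdot> b = Sl2 (e_coeff X * b) (f_coeff X * b) (h_coeff X * b)"

text \<open>The bracket is the bilinear extension of \<open>[u \<otimes> a, v \<otimes> b] = [u, v] \<otimes> ab\<close>,
  see \<open>loop_bracket_tensor\<close>.\<close>

definition tensor_terms :: "'a::field loop \<Rightarrow> ('a sl2 \<times> 'a three_point) list"
  where "tensor_terms X = [(sl2_e, e_coeff X), (sl2_f, f_coeff X), (sl2_h, h_coeff X)]"

definition loop_bracket :: "'a::field loop \<Rightarrow> 'a loop \<Rightarrow> 'a loop"
  where "loop_bracket X Y =
    (\<Sum>(u, a) \<leftarrow> tensor_terms X. \<Sum>(v, b) \<leftarrow> tensor_terms Y. sl2_bracket u v \<otimes> (a * b))"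

lemma tensor_coeffs [simp]:
  "e_coeff (u \<otimes> a) = tp_const (e_coeff u) * a"
  "f_coeff (u \<otimes> a) = tp_const (f_coeff u) * a"
  "h_coeff (u \<otimes> a) = tp_const (h_coeff u) * a"
  by (simp_all add: tensor_def)

lemma loop_rmult_coeffs [simp]:
  "e_coeff (X \<cdot> b) = e_coeff X * b"
  "f_coeff (X \<cdot> b) = f_coeff X * b"
  "h_coeff (X \<cdot> b) = h_coeff X * b"
  by (simp_all add: loop_rmult_def)

lemma tensor_terms_sum: "(\<Sum>(u, a) \<leftarrow> tensor_terms X. u \<otimes> a) = X"
  by (simp add: tensor_terms_def sl2_eq_iff sl2_e_def sl2_f_def sl2_h_def tp_const_0 tp_const_1)

lemma tensor_rmult: "(u \<otimes> a) \<cdot> b = u \<otimes> (a * b)"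
  by (simp add: sl2_eq_iff mult.assoc)

lemma loop_bracket_eq_sl2_bracket: "loop_bracket X Y = sl2_bracket X Y"
  by (simp add: loop_bracket_def tensor_terms_def sl2_eq_iff sl2_bracket_def
      sl2_e_def sl2_f_def sl2_h_def tp_const_0 tp_const_1 tp_const_minus tp_const_numeral
      algebra_simps)

lemma loop_bracket_tensor: "loop_bracket (u \<otimes> a) (v \<otimes> b) = sl2_bracket u v \<otimes> (a * b)"
  by (simp add: loop_bracket_eq_sl2_bracket sl2_eq_iff sl2_bracket_def
      tp_const_mult tp_const_diff tp_const_minus tp_const_numeral algebra_simps)

interpretation loop: lie_algebra loop_scale loop_bracket
  by unfold_locales
    (simp_all add: loop_scale_def loop_bracket_eq_sl2_bracket sl2_eq_iff sl2_bracket_def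
      tp_const_add tp_const_mult tp_const_1 algebra_simps)

lemma tensor_bilinear:
  "(u + v) \<otimes> a = u \<otimes> a + v \<otimes> a"
  "u \<otimes> (a + b) = u \<otimes> a + u \<otimes> b"
  "sl2_scale c u \<otimes> a = loop_scale c (u \<otimes> a)"
  "u \<otimes> (tp_const c * a) = loop_scale c (u \<otimes> a)"
  by (simp_all add: sl2_eq_iff loop_scale_def tp_const_add tp_const_mult algebra_simps)

lemma tensor_universal:
  fixes scaleW :: "'a::field \<Rightarrow> 'w::ab_group_add \<Rightarrow> 'w"
    and g :: "'a sl2 \<Rightarrow> 'a three_point \<Rightarrow> 'w"
  assumes W: "vector_space scaleW"
    and add1: "\<And>u v a. g (u + v) a = g u a + g v a"
    and add2: "\<And>u a b. g u (a + b) = g u a + g u b"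
    and scale1: "\<And>c u a. g (sl2_scale c u) a = scaleW c (g u a)"
    and scale2: "\<And>c u a. g u (tp_const c * a) = scaleW c (g u a)"
  shows "\<exists>!l. Vector_Spaces.linear loop_scale scaleW l \<and> (\<forall>u a. l (u \<otimes> a) = g u a)"
proof -
  interpret W: vector_space scaleW by (rule W)
  define l where
    "l X = g sl2_e (e_coeff X) + g sl2_f (f_coeff X) + g sl2_h (h_coeff X)" for X
  have lin: "Vector_Spaces.linear loop_scale scaleW l"
    by unfold_locales
      (simp_all add: l_def loop_scale_def add2 scale2 W.scale_right_distrib)
  have lt: "l (u \<otimes> a) = g u a" for u a
  proof -
    have u: "u = sl2_scale (e_coeff u) sl2_e + sl2_scale (f_coeff u) sl2_f
        + sl2_scale (h_coeff u) sl2_h"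
      by (simp add: sl2_eq_iff sl2_e_def sl2_f_def sl2_h_def)
    show ?thesis
      by (subst (2) u) (simp add: l_def scale2 add1 scale1)
  qed
  show ?thesis
  proof (rule ex1I[of _ l])
    show "Vector_Spaces.linear loop_scale scaleW l \<and> (\<forall>u a. l (u \<otimes> a) = g u a)"
      using lin lt by blast
  next
    fix m
    assume m: "Vector_Spaces.linear loop_scale scaleW m \<and> (\<forall>u a. m (u \<otimes> a) = g u a)"
    then interpret m: Vector_Spaces.linear loop_scale scaleW m by blast
    show "m = l"
    proof
      fix X
      have "m X = m (\<Sum>(u, a) \<leftarrow> tensor_terms X. u \<otimes> a)"
        by (simp only: tensor_terms_sum)
      also have "\<dots> = l X"
        using m by (simp add: tensor_terms_def m.add l_def add.assoc)
      finally show "m X = l X" .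
    qed
  qed
qed


section \<open>The Onsager Lie algebra\<close>

definition onsager_A :: "'a::field loop"
  where "onsager_A = sl2_x \<otimes> 1"

definition onsager_B :: "'a::field loop"
  where "onsager_B = sl2_y \<otimes> tp_t + sl2_z \<otimes> (tp_t - 1)"

text \<open>The Onsager Lie algebra is identified with its image in \<open>L(sl\<^sub>2)\<^sup>+\<close>.\<close>

definition onsager :: "'a::field loop set"
  where "onsager = loop.generated_subalgebra {onsager_A, onsager_B}"

lemma onsager_relations:
  fixes A B :: "'a::field loop"
  defines "A \<equiv> onsager_A" and "B \<equiv> onsager_B"
  shows "loop_bracket A (loop_bracket A (loop_bracket A B)) = loop_scale 4 (loop_bracket A B)"
    and "loop_bracket B (loop_bracket B (loop_bracket B A)) = loop_scale 4 (loop_bracket B A)"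
  unfolding A_def B_def
  by (simp_all add: loop_bracket_eq_sl2_bracket sl2_eq_iff sl2_bracket_def loop_scale_def
      onsager_A_def onsager_B_def sl2_x_def sl2_y_def sl2_z_def sl2_e_def sl2_f_def sl2_h_def
      tp_const_0 tp_const_1 tp_const_minus tp_const_numeral algebra_simps)

definition A_upup :: "nat \<Rightarrow> 'a::field loop"
  where "A_upup i = sl2_x \<otimes> (tp_t - 1) ^ i"

definition B_upup :: "nat \<Rightarrow> 'a::field loop"
  where "B_upup i = (sl2_y \<otimes> tp_t + sl2_z \<otimes> (tp_t - 1)) \<cdot> (tp_t - 1) ^ i"

definition psi_upup :: "nat \<Rightarrow> 'a::field loop"
  where "psi_upup i = sl2_z \<otimes> (tp_t - 1) ^ i"

datatype onsager_index = IndexA nat | IndexB nat | IndexPsi nat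

text \<open>The \<open>\<psi>\<close> part of the basis starts at \<open>\<psi>\<^sub>1\<close>.\<close>

fun upup_family :: "onsager_index \<Rightarrow> 'a::field loop"
  where
    "upup_family (IndexA i) = A_upup i"
  | "upup_family (IndexB i) = B_upup i"
  | "upup_family (IndexPsi i) = psi_upup (i + 1)"

end

theory Submission
  imports Defs
begin

text \<open>Put \<open>s = t - 1\<close>. In the coordinates of \<open>e, f, h\<close> the proposed basis vectors are
  \<open>(2, 0, -1) s\<^sup>i\<close>, \<open>(0, -2t, -1) s\<^sup>i\<close> and \<open>(0, 0, 1) s\<^sup>i\<^sup>+\<^sup>1\<close>, so independence
  is triangular and comes down to the independence of the powers of \<open>s\<close> in \<open>F[t]\<close>.
  The bracket formulas show that the span is closed under brackets, and they also generate the
  family from \<open>A\<close> and \<open>B\<close>: \<open>[A\<^sub>i, B\<^sub>0]\<close> yields \<open>\<psi>\<^sub>i\<^sub>+\<^sub>1\<close>, after which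
  \<open>[\<psi>\<^sub>1, A\<^sub>i]\<close> yields \<open>A\<^sub>i\<^sub>+\<^sub>1\<close> and \<open>[B\<^sub>i, \<psi>\<^sub>1]\<close> yields \<open>B\<^sub>i\<^sub>+\<^sub>1\<close>.\<close>

section \<open>Independence of indexed families, and subalgebras given by spans\<close>

text \<open>Relations over finite index sets control both claims: a repeated value
  \<open>b i = b j\<close> gives the relation \<open>b i - b j = 0\<close> with coefficient 1 at
  \<open>i\<close>, and once \<open>b\<close> is injective a relation on a subset of the range pulls
  back to indices.\<close>

lemma (in vector_space) family_independentI:
  assumes *: "\<And>S c i. finite S \<Longrightarrow> (\<Sum>i\<in>S. scale (c i) (b i)) = 0 \<Longrightarrow> i \<in> S \<Longrightarrow> c i = 0"
  shows "inj b \<and> independent (range b)"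
proof
  show inj: "inj b"
  proof (rule injI, rule ccontr)
    fix i j assume "b i = b j" "i \<noteq> j"
    then have "(\<Sum>k\<in>{i, j}. scale (if k = i then 1 else - 1) (b k)) = 0"
      by simp
    from *[OF _ this, of i] show False by simp
  qed
  show "independent (range b)"
    unfolding independent_explicit_module
  proof (intro allI impI)
    fix T u v
    assume T: "finite T" "T \<subseteq> range b" "(\<Sum>v\<in>T. scale (u v) v) = 0" "v \<in> T"
    from T(1,2) obtain S where S: "finite S" "T = b ` S"
      by (meson finite_subset_image)
    have "(\<Sum>i\<in>S. scale (u (b i)) (b i)) = 0"
      using T(3) S(2) inj by (simp add: sum.reindex inj_on_subset)
    with * S T(4) show "u v = 0" by auto
  qed
qed

text \<open>Bilinearity extends closure in two passes: first the right argument runs through the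
  span with the left one in \<open>S\<close>, then the left argument does.\<close>

lemma (in lie_algebra) lie_subalgebra_span:
  assumes *: "\<And>u v. u \<in> S \<Longrightarrow> v \<in> S \<Longrightarrow> bracket u v \<in> span S"
  shows "lie_subalgebra (span S)"
  unfolding lie_subalgebra_def
proof (intro conjI ballI subspace_span)
  have zero: "bracket 0 v = 0" "bracket v 0 = 0" for v
    using bracket_scale_left[of 0 0 v] bracket_scale_right[of v 0 0] by simp_all
  have right: "bracket u v \<in> span S" if u: "u \<in> S" and "v \<in> span S" for u v
    using that(2)
    by (induction rule: span_induct_alt)
      (auto simp: zero bracket_add_right bracket_scale_right span_zero intro!: span_add span_scale * u)
  fix u v assume "u \<in> span S" and v: "v \<in> span S"
  then show "bracket u v \<in> span S"
    by (induction rule: span_induct_alt)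
      (auto simp: zero bracket_add_left bracket_scale_left span_zero intro!: span_add span_scale right)
qed

lemma (in lie_algebra) bracket_antisym: "bracket v u = - bracket u v"
proof -
  have "bracket u v + bracket v u = bracket (u + v) (u + v)"
    by (simp only: bracket_add_left bracket_add_right bracket_self[of u] bracket_self[of v]
        add_0_left add_0_right add.commute)
  then have "bracket u v + bracket v u = 0"
    by (simp only: bracket_self)
  then show ?thesis by (simp add: add_eq_0_iff)
qed

section \<open>Polynomials inside the three-point algebra\<close>

lemma Fract_poly_in_three_point_set: "Fract p 1 \<in> three_point_set"
proof (induction p)
  case 0
  then show ?case using three_point_set.const[of 0] by simp
next
  case (pCons a p)
  have "Fract (pCons a p) 1 = Fract [:a:] 1 + Fract [:0, 1:] 1 * Fract p 1"
    by simp
  then show ?case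
    using pCons.IH by (metis three_point_set.intros(1,2,5,6))
qed

text \<open>The embedding of \<open>F[t]\<close> into the three-point algebra, used to carry
  relations among powers of \<open>t - 1\<close> back to polynomials.\<close>

definition tp_poly :: "'a::field poly \<Rightarrow> 'a three_point"
  where "tp_poly p = Abs_three_point (Fract p 1)"

lemma Rep_tp_poly: "Rep_three_point (tp_poly p) = Fract p 1"
  unfolding tp_poly_def by (intro Abs_three_point_inverse Fract_poly_in_three_point_set)

lemma tp_poly_add: "tp_poly (p + q) = tp_poly p + tp_poly q"
  by (simp add: Rep_tp_poly plus_three_point.rep_eq flip: Rep_three_point_inject)

lemma tp_poly_mult: "tp_poly (p * q) = tp_poly p * tp_poly q"
  by (simp add: Rep_tp_poly times_three_point.rep_eq flip: Rep_three_point_inject)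

lemma tp_poly_const: "tp_poly [:c:] = tp_const c"
  by (simp add: Rep_tp_poly tp_const.rep_eq flip: Rep_three_point_inject)

lemma tp_poly_indeterminate: "tp_poly [:0, 1:] = tp_t"
  by (simp add: Rep_tp_poly tp_t.rep_eq flip: Rep_three_point_inject)

lemma tp_poly_0: "tp_poly 0 = 0"
  using tp_poly_const[of 0] by (simp add: tp_const_0)

lemma tp_poly_1: "tp_poly 1 = 1"
  using tp_poly_const[of 1] by (simp add: tp_const_1 one_pCons)

lemma tp_poly_sum: "tp_poly (sum f S) = (\<Sum>i\<in>S. tp_poly (f i))"
  by (induction S rule: infinite_finite_induct) (simp_all add: tp_poly_0 tp_poly_add)

lemma tp_poly_power: "tp_poly (p ^ n) = tp_poly p ^ n"
  by (induction n) (simp_all add: tp_poly_1 tp_poly_mult)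

lemma tp_poly_eq_0_iff: "tp_poly p = 0 \<longleftrightarrow> p = 0"
  by (simp add: Rep_tp_poly zero_three_point.rep_eq Zero_fract_def eq_fract
      flip: Rep_three_point_inject)

lemma tp_poly_t1: "tp_poly [:-1, 1:] = tp_t - 1"
proof -
  have "tp_poly [:-1, 1:] + 1 = tp_poly [:0, 1:]"
    by (simp add: tp_poly_add[symmetric] tp_poly_1[symmetric] one_pCons)
  also have "\<dots> = tp_t" by (rule tp_poly_indeterminate)
  finally show ?thesis by (simp add: eq_diff_eq)
qed

text \<open>The relation is the image of the polynomial with coefficients \<open>c i\<close>,
  composed with \<open>[:-1, 1:]\<close>. Composition with a polynomial of positive degree kills
  only 0.\<close>

lemma powers_t1_independent:
  assumes "finite S" "(\<Sum>i\<in>S. tp_const (c i) * (tp_t - 1) ^ i) = 0" "i \<in> S"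
  shows "c i = (0 :: 'a::field)"
proof -
  let ?p = "\<Sum>i\<in>S. monom (c i) i"
  have power: "pcompose (q ^ n) r = pcompose q r ^ n" for q r :: "'a poly" and n
    by (induction n) (simp_all add: pcompose_1 pcompose_mult)
  have "pcompose ?p [:-1, 1:] = (\<Sum>i\<in>S. [:c i:] * [:-1, 1:] ^ i)"
    by (simp add: pcompose_sum monom_altdef pcompose_smult power pcompose_pCons)
  also have "tp_poly \<dots> = 0"
    using assms(2) by (simp only: tp_poly_sum tp_poly_mult tp_poly_power tp_poly_const tp_poly_t1)
  finally have "pcompose ?p [:-1, 1:] = 0"
    by (simp add: tp_poly_eq_0_iff)
  then have "?p = 0"
    by (rule pcompose_eq_0) simp
  then have "coeff ?p i = 0" by simp
  then show ?thesis
    using assms(1,3) by (simp add: coeff_sum)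
qed

section \<open>Bracket formulas, as ring identities in the three coordinates\<close>

lemmas loop_simps = loop_bracket_eq_sl2_bracket sl2_eq_iff sl2_bracket_def loop_scale_def
  sl2_x_def sl2_y_def sl2_z_def sl2_e_def sl2_f_def sl2_h_def
  tp_const_0 tp_const_1 tp_const_minus tp_const_numeral

lemma bracket_A_A: "loop_bracket (A_upup i) (A_upup j) = 0"
  by (simp add: A_upup_def loop_simps algebra_simps)

lemma bracket_B_B: "loop_bracket (B_upup i) (B_upup j) = 0"
  by (simp add: B_upup_def loop_simps algebra_simps)

lemma bracket_psi_psi: "loop_bracket (psi_upup i) (psi_upup j) = 0"
  by (simp add: psi_upup_def loop_simps algebra_simps)

lemma bracket_psi_A:
  "loop_bracket (psi_upup i) (A_upup j) =
    loop_scale 2 (psi_upup (i + j)) + loop_scale 2 (A_upup (i + j))"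
  by (simp add: psi_upup_def A_upup_def loop_simps power_add algebra_simps)

lemma bracket_B_psi:
  "loop_bracket (B_upup i) (psi_upup j) =
    loop_scale 2 (B_upup (i + j)) + loop_scale 2 (psi_upup (i + j))"
  by (simp add: psi_upup_def B_upup_def loop_simps power_add algebra_simps)

text \<open>For \<open>i = j = 0\<close> the equitable relations give
  \<open>(2x + 2y) t - (2z + 2x)(t - 1)\<close>, which is
  \<open>2x + 2(y t + z (t - 1)) - 4z (t - 1)\<close>. The factor \<open>t - 1\<close> on the last
  \<open>z\<close> causes the index shift of \<open>psi_upup\<close>.\<close>

lemma bracket_A_B:
  "loop_bracket (A_upup i) (B_upup j) =
    loop_scale 2 (A_upup (i + j)) + loop_scale 2 (B_upup (i + j))
      - loop_scale 4 (psi_upup (i + j + 1))"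
  by (simp add: A_upup_def B_upup_def psi_upup_def loop_simps power_add algebra_simps)

lemma A_upup_0: "A_upup 0 = onsager_A"
  by (simp add: A_upup_def onsager_A_def)

lemma B_upup_0: "B_upup 0 = onsager_B"
  by (simp add: B_upup_def onsager_B_def sl2_eq_iff)

section \<open>Linear independence of the family\<close>

lemma sum_onsager_index:
  assumes "finite S"
  shows "(\<Sum>k\<in>S. g k) = (\<Sum>i\<in>IndexA -` S. g (IndexA i)) +
    (\<Sum>i\<in>IndexB -` S. g (IndexB i)) + (\<Sum>i\<in>IndexPsi -` S. g (IndexPsi i))"
proof -
  define I J K where IJK: "I = IndexA -` S" "J = IndexB -` S" "K = IndexPsi -` S"
  have S: "S = IndexA ` I \<union> IndexB ` J \<union> IndexPsi ` K"
  proof (intro equalityI subsetI)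
    fix k assume "k \<in> S"
    then show "k \<in> IndexA ` I \<union> IndexB ` J \<union> IndexPsi ` K"
      by (cases k) (auto simp: IJK)
  qed (auto simp: IJK)
  have fin: "finite I" "finite J" "finite K"
    using assms by (auto simp: IJK intro!: finite_vimageI injI)
  have "sum g S = sum g (IndexA ` I \<union> IndexB ` J) + sum g (IndexPsi ` K)"
    by (subst S, rule sum.union_disjoint) (use fin in auto)
  also have "sum g (IndexA ` I \<union> IndexB ` J) = sum g (IndexA ` I) + sum g (IndexB ` J)"
    by (rule sum.union_disjoint) (use fin in auto)
  finally show ?thesis
    by (simp add: sum.reindex inj_on_def flip: IJK)
qed

lemma coeff_sum_sl2:
  "e_coeff (sum g S) = (\<Sum>k\<in>S. e_coeff (g k))"
  "f_coeff (sum g S) = (\<Sum>k\<in>S. f_coeff (g k))"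
  "h_coeff (sum g S) = (\<Sum>k\<in>S. h_coeff (g k))"
  by (induction S rule: infinite_finite_induct; simp)+

text \<open>In the \<open>psi_upup\<close> case one factor \<open>t - 1\<close> stays separate, to
  be pulled out of a sum and cancelled as a unit.\<close>

lemma h_coeff_upup:
  "h_coeff (A_upup i) = - ((tp_t - 1) ^ i)"
  "h_coeff (B_upup i) = - ((tp_t - 1) ^ i)"
  "h_coeff (psi_upup (Suc i)) = (tp_t - 1) * (tp_t - 1) ^ i"
  by (simp_all add: A_upup_def B_upup_def psi_upup_def loop_simps algebra_simps)

text \<open>Multiply \<open>a * b = 0\<close> by the inverse of \<open>a\<close>. The factors to be
  cancelled are nonzero constants, \<open>t\<close> and \<open>t - 1\<close>, all of them
  units.\<close>

lemma unit_cancel: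
  fixes a :: "'r::comm_ring_1"
  assumes "\<exists>u. a * u = 1" "a * b = 0"
  shows "b = 0"
  using assms by (metis mult.assoc mult.commute mult_1 mult_zero_right)

lemma tp_const_unit: "c \<noteq> 0 \<Longrightarrow> \<exists>u. tp_const c * u = 1"
  by (rule exI[of _ "tp_const (inverse c)"]) (simp add: tp_const_1 flip: tp_const_mult)

lemma upup_family_independent:
  fixes c :: "onsager_index \<Rightarrow> 'a::field_char_0"
  assumes S: "finite S" and sum: "(\<Sum>k\<in>S. loop_scale (c k) (upup_family k)) = 0" and k: "k \<in> S"
  shows "c k = 0"
proof -
  define s :: "'a three_point" where "s = tp_t - 1"
  define p where "p = (\<Sum>i\<in>IndexA -` S. tp_const (c (IndexA i)) * s ^ i)"
  define q where "q = (\<Sum>i\<in>IndexB -` S. tp_const (c (IndexB i)) * s ^ i)"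
  define r where "r = (\<Sum>i\<in>IndexPsi -` S. tp_const (c (IndexPsi i)) * s ^ i)"
  have fin: "finite (IndexA -` S)" "finite (IndexB -` S)" "finite (IndexPsi -` S)"
    using S by (auto intro!: finite_vimageI injI)
  note coeffs = coeff_sum_sl2 sum_onsager_index[OF S] A_upup_def B_upup_def psi_upup_def loop_simps
  \<comment> \<open>Only the \<open>A_upup i\<close> have an \<open>e\<close> coordinate, and 2 is
    invertible in characteristic zero.\<close>
  have "tp_const 2 * p = e_coeff (\<Sum>k\<in>S. loop_scale (c k) (upup_family k))"
    by (simp add: coeffs p_def s_def sum_distrib_left mult_ac)
  then have p: "p = 0"
    unfolding sum by (intro unit_cancel[OF tp_const_unit[of 2], of p]) simp_all
  \<comment> \<open>Only the \<open>B_upup i\<close> have an \<open>f\<close> coordinate; both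
    \<open>-2\<close> and \<open>t\<close> are cancelled.\<close>
  have "tp_const (- 2) * (tp_t * q) = f_coeff (\<Sum>k\<in>S. loop_scale (c k) (upup_family k))"
    by (simp add: coeffs q_def s_def sum_distrib_left sum_negf mult_ac)
  then have q: "q = 0"
    unfolding sum
    by (intro unit_cancel[OF tp_t_unit, of q] unit_cancel[OF tp_const_unit[of "- 2"], of "tp_t * q"])
      simp_all
  \<comment> \<open>All three kinds contribute to \<open>h\<close>, but \<open>p\<close> and
    \<open>q\<close> already vanish.\<close>
  have "- p - q + s * r = h_coeff (\<Sum>k\<in>S. loop_scale (c k) (upup_family k))"
    by (simp add: coeff_sum_sl2 sum_onsager_index[OF S] h_coeff_upup loop_scale_def
        p_def q_def r_def sum_distrib_left sum_negf mult.left_commute flip: s_def)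
  then have r: "r = 0"
    unfolding sum p q by (intro unit_cancel[OF tp_t1_unit, of r]) (simp add: s_def)
  show ?thesis
  proof (cases k)
    case (IndexA i)
    then show ?thesis
      using powers_t1_independent[OF fin(1) p[unfolded p_def s_def]] k by simp
  next
    case (IndexB i)
    then show ?thesis
      using powers_t1_independent[OF fin(2) q[unfolded q_def s_def]] k by simp
  next
    case (IndexPsi i)
    then show ?thesis
      using powers_t1_independent[OF fin(3) r[unfolded r_def s_def]] k by simp
  qed
qed

section \<open>The span is the subalgebra generated by \<open>A\<close> and \<open>B\<close>\<close>

lemma span_upup_family:
  "loop.span (range upup_family) = (onsager :: 'a::field_char_0 loop set)"
proof
  let ?V = "loop.span (range upup_family) :: 'a loop set"
  let ?O = "onsager :: 'a loop set"
  have A: "A_upup i \<in> ?V" and B: "B_upup i \<in> ?V" and psi: "psi_upup (Suc i) \<in> ?V" for i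
    using loop.span_base[OF rangeI[of upup_family "IndexA i"]]
      loop.span_base[OF rangeI[of upup_family "IndexB i"]]
      loop.span_base[OF rangeI[of upup_family "IndexPsi i"]] by simp_all
  note closed = A B psi loop.span_zero loop.span_add loop.span_diff loop.span_scale loop.span_neg
  \<comment> \<open>The \<open>Suc\<close> in the \<open>psi_upup\<close> arguments keeps every
    resulting \<open>psi_upup\<close> index positive, so \<open>psi_upup 0\<close>, which is outside
    the family, never appears.\<close>
  have brackets: "loop_bracket (A_upup i) (B_upup j) \<in> ?V"
    "loop_bracket (psi_upup (Suc i)) (A_upup j) \<in> ?V"
    "loop_bracket (B_upup i) (psi_upup (Suc j)) \<in> ?V" for i j
    by (auto simp: bracket_A_B bracket_psi_A bracket_B_psi intro!: closed)
  \<comment> \<open>The mixed pairs in the opposite order follow by antisymmetry, hence the negated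
    copies of \<open>brackets\<close>.\<close>
  have "loop_bracket (upup_family k) (upup_family l) \<in> ?V" for k l
    using brackets brackets[THEN loop.span_neg]
    by (cases k; cases l)
      (auto simp: bracket_A_A bracket_B_B bracket_psi_psi loop.span_zero
        simp flip: loop.bracket_antisym)
  then have "loop.lie_subalgebra ?V"
    by (intro loop.lie_subalgebra_span) auto
  moreover have "{onsager_A, onsager_B} \<subseteq> ?V"
    using A[of 0] B[of 0] by (simp add: A_upup_0 B_upup_0)
  ultimately show "?O \<subseteq> ?V"
    unfolding onsager_def by (intro loop.generated_subalgebra_minimal)

  have sub: "loop.lie_subalgebra ?O"
    unfolding onsager_def by (rule loop.lie_subalgebra_generated)
  then have subspace: "loop.subspace ?O"
    and bracket: "\<And>u v. u \<in> ?O \<Longrightarrow> v \<in> ?O \<Longrightarrow> loop_bracket u v \<in> ?O"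
    unfolding loop.lie_subalgebra_def by blast+
  note closed = loop.subspace_add[OF subspace] loop.subspace_diff[OF subspace]
    loop.subspace_scale[OF subspace]
  \<comment> \<open>Used to divide by the structure constants 4 and 2, nonzero in characteristic
    zero.\<close>
  have cancel: "v \<in> ?O" if "loop_scale d v = w" "w \<in> ?O" "d \<noteq> 0" for d v w
  proof -
    have "v = loop_scale (inverse d) w" using that by auto
    then show ?thesis using that(2) by (simp add: closed)
  qed
  have psi_step: "psi_upup (Suc i) \<in> ?O" if "A_upup i \<in> ?O" "B_upup 0 \<in> ?O" "B_upup i \<in> ?O" for i
    by (rule cancel[of 4 _ "loop_scale 2 (A_upup i) + loop_scale 2 (B_upup i)
        - loop_bracket (A_upup i) (B_upup 0)"])
      (simp add: bracket_A_B, intro closed bracket that, simp)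
  have AB0: "A_upup 0 \<in> ?O" "B_upup 0 \<in> ?O"
    using loop.generators_subset[of "{onsager_A, onsager_B}"]
    by (auto simp: A_upup_0 B_upup_0 onsager_def)
  note psi1 = psi_step[OF AB0 AB0(2)]
  \<comment> \<open>Both families climb together: \<open>psi_step\<close> needs
    \<open>A_upup i\<close> and \<open>B_upup i\<close>, and its result is the term subtracted in
    both passages to \<open>Suc i\<close>.\<close>
  have AB: "A_upup i \<in> ?O \<and> B_upup i \<in> ?O" for i
  proof (induction i)
    case 0
    then show ?case using AB0 by simp
  next
    case (Suc i)
    then have psi: "psi_upup (Suc i) \<in> ?O" using psi_step AB0 by simp
    have "A_upup (Suc i) \<in> ?O"
      by (rule cancel[of 2 _ "loop_bracket (psi_upup (Suc 0)) (A_upup i)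
          - loop_scale 2 (psi_upup (Suc i))"])
        (simp add: bracket_psi_A, use psi psi1 Suc in \<open>auto intro!: closed(2,3) bracket\<close>)
    moreover have "B_upup (Suc i) \<in> ?O"
      by (rule cancel[of 2 _ "loop_bracket (B_upup i) (psi_upup (Suc 0))
          - loop_scale 2 (psi_upup (Suc i))"])
        (simp add: bracket_B_psi, use psi psi1 Suc in \<open>auto intro!: closed(2,3) bracket\<close>)
    ultimately show ?case by simp
  qed
  have "upup_family k \<in> ?O" for k
    using AB AB0 psi_step by (cases k) auto
  then show "?V \<subseteq> ?O"
    by (intro loop.span_minimal subspace) auto
qed

theorem theorem6p3:
  shows "loop.basis_family upup_family (onsager :: 'a::field_char_0 loop set) \<and>
    A_upup 0 = (onsager_A :: 'a loop) \<and>
    B_upup 0 = (onsager_B :: 'a loop) \<and>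
    (\<forall>i j.
      loop_bracket (A_upup i) (A_upup j) = (0 :: 'a loop) \<and>
      loop_bracket (B_upup i) (B_upup j) = (0 :: 'a loop) \<and>
      loop_bracket (psi_upup i) (psi_upup j) = (0 :: 'a loop) \<and>
      loop_bracket (psi_upup i) (A_upup j) =
        loop_scale (2 :: 'a) (psi_upup (i + j)) + loop_scale 2 (A_upup (i + j)) \<and>
      loop_bracket (B_upup i) (psi_upup j) =
        loop_scale (2 :: 'a) (B_upup (i + j)) + loop_scale 2 (psi_upup (i + j)) \<and>
      loop_bracket (A_upup i) (B_upup j) =
        loop_scale (2 :: 'a) (A_upup (i + j)) + loop_scale 2 (B_upup (i + j))
          - loop_scale 4 (psi_upup (i + j + 1)))"
proof -
  have "inj (upup_family :: _ \<Rightarrow> 'a loop) \<and> loop.independent (range upup_family :: 'a loop set)"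
    by (rule loop.family_independentI) (rule upup_family_independent)
  then show ?thesis
    by (simp add: loop.basis_family_def span_upup_family A_upup_0 B_upup_0 bracket_A_A bracket_B_B
        bracket_psi_psi bracket_psi_A bracket_B_psi bracket_A_B)
qed

end
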